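(* Let $m$ be a locally doubling flow measure on a tree $T$ rooted at infinity with vertex set $V$. Then $m$ has at least exponential growth if and only if for all $x_0\in V$ there exist $r_0=r_0(x_0)\in\mathbb N$ and $\alpha=\alpha(x_0)>0$ such that $n([x_1,x_r])\ge\alpha r$ for all $r>r_0$, where $x_k$ denotes the $k$-th predecessor of $x_0$ and $n([x_1,x_r])=|\{y\in[x_1,x_r]:\ q(y)\ge2\}|$.
   Context: Tree with root at infinity: $T=(V,E)$ is an (undirected) tree with geodesic distance $d$, $o\in V$ is a fixed origin, and a half-infinite geodesic starting at $o$ is fixed, identified with a boundary point, the root. For $x\in V$ let $\Pi(x)$ be the vertex of this geodesic closest to $x$; the level of $x$ is $\ell(x)=d(o,\Pi(x))-d(\Pi(x),x)$. The predecessor $p(x)$ is the unique neighbour of $x$ with level $\ell(x)+1$; given $x_0$, set $x_k=p(x_{k-1})$ for $k\ge1$. The set of sons of $x$ is $s(x)=\{y\sim x:\ \ell(y)=\ell(x)-1\}$, and $q(x)=|s(x)|$. $[x,y]$ denotes the set of vertices of the geodesic joining $x$ to $y$. Flow measure: a function $m:V\to(0,\infty)$ with $m(x)=\sum_{y\in s(x)}m(y)$ for all $x\in V$; also regarded as the measure $m(A)=\sum_{x\in A}m(x)$. It is locally doubling if for every $r>0$ there is $C_r>1$ with $m(B_{2r}(x))\le C_r m(B_r(x))$ for all $x\in V$, where $B_r(x)=\{y\in V:d(x,y)\le r\}$, $r\in\mathbb N$. Growth: $m$ has at least exponential growth if for all $x_0\in V$ there exist $r_0=r_0(x_0)\in\mathbb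 N$, $\beta=\beta(x_0)>0$ and $\alpha=\alpha(x_0)>0$ such that $m(B_r(x_0))\ge\beta e^{\alpha r}$ for all $r>r_0$. *)

theory Defs
  imports "HOL-Analysis.Analysis" "HOL-Library.Extended_Nat"
begin

locale simple_graph =
  fixes V :: "'a set" and E :: "'a set set"
  assumes edges: "E \<subseteq> {{x, y} | x y. x \<in> V \<and> y \<in> V \<and> x \<noteq> y}"
begin

definition walk :: "'a list \<Rightarrow> bool" where
  "walk xs \<longleftrightarrow> xs \<noteq> [] \<and> set xs \<subseteq> V \<and> successively (\<lambda>x y. {x, y} \<in> E) xs"

definition walk_betw :: "'a \<Rightarrow> 'a list \<Rightarrow> 'a \<Rightarrow> bool" where
  "walk_betw x xs y \<longleftrightarrow> walk xs \<and> hd xs = x \<and> last xs = y"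

text \<open>A cycle lists its vertices once; the closing edge joins the last one to the first.\<close>

definition cycle :: "'a list \<Rightarrow> bool" where
  "cycle xs \<longleftrightarrow> walk xs \<and> distinct xs \<and> length xs \<ge> 3 \<and> {last xs, hd xs} \<in> E"

text \<open>A walk with \<open>k + 1\<close> vertices has length \<open>k\<close>.\<close>

definition gdist :: "'a \<Rightarrow> 'a \<Rightarrow> nat" where
  "gdist x y = (LEAST k. \<exists>xs. walk_betw x xs y \<and> length xs = k + 1)"

definition geodesic :: "'a \<Rightarrow> 'a list \<Rightarrow> 'a \<Rightarrow> bool" where
  "geodesic x xs y \<longleftrightarrow> walk_betw x xs y \<and> length xs = gdist x y + 1"

text \<open>The segment \<open>[x, y]\<close>; in a tree there is exactly one geodesic from \<open>x\<close> to \<open>y\<close>.\<close>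

definition segment :: "'a \<Rightarrow> 'a \<Rightarrow> 'a set" where
  "segment x y = {z. \<exists>xs. geodesic x xs y \<and> z \<in> set xs}"

definition gball :: "'a \<Rightarrow> nat \<Rightarrow> 'a set" where
  "gball x r = {y \<in> V. gdist x y \<le> r}"

end

locale tree = simple_graph +
  assumes nonempty: "V \<noteq> {}"
    and connected: "\<And>x y. x \<in> V \<Longrightarrow> y \<in> V \<Longrightarrow> \<exists>xs. walk_betw x xs y"
    and acyclic: "\<And>xs. \<not> cycle xs"

text \<open>A function on vertices regarded as a measure. Values are in \<open>[0, \<infinity>]\<close>, so that no
  finiteness of the vertex set or of the degrees has to be presupposed.\<close>

definition mass :: "('a \<Rightarrow> real) \<Rightarrow> 'a set \<Rightarrow> ennreal" where
  "mass m A = infsum (\<lambda>x. ennreal (m x)) A"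

text \<open>The root at infinity is the end of the geodesic ray \<open>ray\<close>; the origin is \<open>ray 0\<close>.\<close>

locale rooted_tree = tree V E for V :: "'a set" and E :: "'a set set" +
  fixes ray :: "nat \<Rightarrow> 'a"
  assumes ray_in: "\<And>i. ray i \<in> V"
    and ray_geodesic: "\<And>i j. i \<le> j \<Longrightarrow> gdist (ray i) (ray j) = j - i"
begin

definition proj :: "'a \<Rightarrow> 'a" where
  "proj x = arg_min (gdist x) (\<lambda>v. v \<in> range ray)"

definition level :: "'a \<Rightarrow> int" where
  "level x = int (gdist (ray 0) (proj x)) - int (gdist (proj x) x)"

definition pred :: "'a \<Rightarrow> 'a" where
  "pred x = (THE y. {x, y} \<in> E \<and> level y = level x + 1)"

definition sons :: "'a \<Rightarrow> 'a set" where
  "sons x = {y. {x, y} \<in> E \<and> level y = level x - 1}"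

text \<open>\<open>card\<close> would give \<open>0\<close> for an infinite set of sons.\<close>

definition q :: "'a \<Rightarrow> enat" where
  "q x = (if finite (sons x) then enat (card (sons x)) else \<infinity>)"

definition branch_count :: "'a set \<Rightarrow> nat" where
  "branch_count A = card {y \<in> A. q y \<ge> 2}"

definition flow_measure :: "('a \<Rightarrow> real) \<Rightarrow> bool" where
  "flow_measure m \<longleftrightarrow> (\<forall>x\<in>V. m x > 0 \<and> ennreal (m x) = mass m (sons x))"

definition locally_doubling :: "('a \<Rightarrow> real) \<Rightarrow> bool" where
  "locally_doubling m \<longleftrightarrow>
     (\<forall>r::nat. r > 0 \<longrightarrow> (\<exists>C::real. C > 1 \<and>
        (\<forall>x\<in>V. mass m (gball x (2 * r)) \<le> ennreal C * mass m (gball x r))))"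

definition at_least_exp_growth :: "('a \<Rightarrow> real) \<Rightarrow> bool" where
  "at_least_exp_growth m \<longleftrightarrow>
     (\<forall>x0\<in>V. \<exists>(r0::nat) (\<beta>::real) (\<alpha>::real). \<beta> > 0 \<and> \<alpha> > 0 \<and>
        (\<forall>r>r0. mass m (gball x0 r) \<ge> ennreal (\<beta> * exp (\<alpha> * real r))))"

end

end

theory Submission
  imports Defs "HOL-Real_Asymp.Real_Asymp"
begin

text \<open>Local doubling at radius \<open>1\<close> gives a constant \<open>D\<close> with \<open>m (pred x) \<le> D * m x\<close>; hence degrees
  are finite and, passing from \<open>x\<close> to \<open>pred x\<close>, the measure is unchanged if \<open>q (pred x) = 1\<close> and
  grows by a factor between \<open>1 + 1 / D\<close> and \<open>D\<close> otherwise. So \<open>m x\<^sub>r\<close> is exponential in the number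
  of branching vertices among \<open>x\<^sub>1, \<dots>, x\<^sub>r\<close>. Finally \<open>m x\<^sub>r \<le> m (B\<^sub>r(x\<^sub>0)) \<le> (2 r + 1) m x\<^sub>r\<close>, because the
  ball is contained in the first \<open>2 r + 1\<close> generations of descendants of \<open>x\<^sub>r\<close>, each of which has
  mass \<open>m x\<^sub>r\<close>.\<close>

section \<open>Walks and distances\<close>

context simple_graph
begin

lemma edge_commute: "{x, y} \<in> E \<longleftrightarrow> {y, x} \<in> E"
  by (simp add: insert_commute)

lemma edgeD:
  assumes "{x, y} \<in> E"
  shows "x \<in> V" "y \<in> V" "x \<noteq> y"
  using assms edges by (auto simp: doubleton_eq_iff)

lemma walk_singleton [simp]: "walk [x] \<longleftrightarrow> x \<in> V"
  by (simp add: walk_def)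

lemma walk_Cons [simp]: "walk (x # y # ys) \<longleftrightarrow> {x, y} \<in> E \<and> walk (y # ys)"
  by (auto simp: walk_def dest: edgeD)

lemma walk_betw_singleton [simp]: "walk_betw x [x] x \<longleftrightarrow> x \<in> V"
  by (simp add: walk_betw_def)

lemma walk_betw_Cons: "{x, y} \<in> E \<Longrightarrow> walk_betw y ys z \<Longrightarrow> walk_betw x (x # ys) z"
  by (cases ys) (auto simp: walk_betw_def walk_def dest: edgeD)

lemma walk_betw_rev: "walk_betw x xs y \<Longrightarrow> walk_betw y (rev xs) x"
  by (auto simp: walk_betw_def walk_def hd_rev last_rev insert_commute)

text \<open>\<open>tl\<close> drops the second copy of the shared vertex \<open>y\<close>, so that
  lengths counted in edges add up.\<close>

lemma walk_betw_join:
  assumes "walk_betw x xs y" "walk_betw y ys z"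
  shows "walk_betw x (xs @ tl ys) z"
  using assms
  by (cases ys)
    (auto simp: walk_betw_def walk_def successively_append_iff successively_Cons)

lemma walk_betw_split:
  assumes "walk_betw x (as @ z # bs) y"
  shows "walk_betw x (as @ [z]) z" "walk_betw z (z # bs) y"
  using assms
  by (auto simp: walk_betw_def walk_def successively_append_iff successively_Cons hd_append
      split: if_splits)

lemma gdist_le: "walk_betw x xs y \<Longrightarrow> gdist x y \<le> length xs - 1"
  unfolding gdist_def
  by (rule Least_le) (auto simp: walk_betw_def walk_def neq_Nil_conv intro!: exI[of _ xs])

end

context tree
begin

lemma geodesic_exists:
  assumes "x \<in> V" "y \<in> V"
  obtains xs where "geodesic x xs y"
proof -
  obtain xs where xs: "walk_betw x xs y"
    using connected assms by blast
  then have "length xs = (length xs - 1) + 1"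
    by (cases xs) (auto simp: walk_betw_def walk_def)
  then have "\<exists>k xs. walk_betw x xs y \<and> length xs = k + 1"
    using xs by blast
  from LeastI_ex[OF this] obtain xs where "geodesic x xs y"
    unfolding geodesic_def gdist_def by blast
  then show thesis
    by (rule that)
qed

lemma gdist_commute:
  assumes "x \<in> V" "y \<in> V"
  shows "gdist x y = gdist y x"
proof -
  have "gdist y x \<le> gdist x y" if V: "x \<in> V" "y \<in> V" for x y
  proof -
    obtain xs where "geodesic x xs y"
      using geodesic_exists[OF V] .
    then show ?thesis
      using gdist_le[OF walk_betw_rev, of x xs y] by (simp add: geodesic_def)
  qed
  then show ?thesis
    using assms by (simp add: le_antisym)
qed

lemma gdist_triangle:
  assumes "x \<in> V" "y \<in> V" "z \<in> V"
  shows "gdist x z \<le> gdist x y + gdist y z"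
proof -
  obtain xs ys where "geodesic x xs y" "geodesic y ys z"
    using geodesic_exists assms by metis
  then show ?thesis
    using gdist_le[OF walk_betw_join, of x xs y ys z] by (simp add: geodesic_def)
qed

lemma gdist_self [simp]: "x \<in> V \<Longrightarrow> gdist x x = 0"
  using gdist_le[of x "[x]" x] by simp

lemma gdist_eq_0D:
  assumes "x \<in> V" "y \<in> V" "gdist x y = 0"
  shows "x = y"
proof -
  obtain xs where "geodesic x xs y"
    using geodesic_exists assms by metis
  with assms(3) show ?thesis
    by (cases xs) (auto simp: geodesic_def walk_betw_def)
qed

lemma gdist_edge_le:
  assumes "v \<in> V" "{x, y} \<in> E"
  shows "gdist v y \<le> gdist v x + 1"
proof -
  have "gdist x y \<le> 1"
    using gdist_le[of x "[x, y]" y] assms edgeD[OF assms(2)] by (simp add: walk_betw_def)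
  then show ?thesis
    using gdist_triangle[of v x y] assms edgeD[OF assms(2)] by simp
qed

text \<open>The part of a geodesic up to \<open>z\<close> is itself a walk, strictly shorter because
  \<open>z\<close> is not the last vertex.\<close>

lemma geodesic_gdist_less:
  assumes "geodesic v xs x" "z \<in> set xs" "z \<noteq> x"
  shows "gdist v z < gdist v x"
proof -
  obtain as bs where xs: "xs = as @ z # bs"
    using split_list[OF assms(2)] by blast
  have "bs \<noteq> []"
    using assms xs by (auto simp: geodesic_def walk_betw_def)
  moreover have "gdist v z \<le> length (as @ [z]) - 1"
    using assms(1) walk_betw_split(1) by (intro gdist_le) (auto simp: geodesic_def xs)
  ultimately show ?thesis
    using assms(1) by (cases bs) (auto simp: geodesic_def xs)
qed

text \<open>The second vertex of a geodesic from \<open>x\<close> to \<open>v\<close> serves: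
  dropping \<open>x\<close> shortens the walk by one, and an edge changes distances by at most
  one.\<close>

lemma closer_neighbour_exists:
  assumes "v \<in> V" "x \<in> V" "v \<noteq> x"
  obtains y where "{x, y} \<in> E" "gdist v x = gdist v y + 1"
proof -
  obtain xs where xs: "geodesic x xs v"
    using geodesic_exists assms by metis
  then obtain y ys where ys: "xs = x # y # ys"
    using assms by (cases xs; cases "tl xs") (auto simp: geodesic_def walk_betw_def)
  have e: "{x, y} \<in> E"
    using xs ys by (simp add: geodesic_def walk_betw_def)
  have "gdist y v \<le> length (y # ys) - 1"
    using xs ys by (intro gdist_le) (auto simp: geodesic_def walk_betw_def)
  then have "gdist v y + 1 \<le> gdist v x"
    using xs ys gdist_commute assms edgeD[OF e] by (simp add: geodesic_def)
  moreover have "gdist v x \<le> gdist v y + 1"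
    using gdist_edge_le[of v y x] e assms by (simp add: insert_commute)
  ultimately show thesis
    using that e by simp
qed

text \<open>A shortest walk from \<open>y\<close> to \<open>z\<close> avoiding \<open>x\<close> would close up to a cycle through \<open>x\<close>.\<close>

lemma neighbours_eqI:
  assumes "{x, y} \<in> E" "{x, z} \<in> E" "walk_betw y xs z" "x \<notin> set xs"
  shows "y = z"
proof (rule ccontr)
  assume "y \<noteq> z"
  obtain ys where ys: "walk_betw y ys z" "x \<notin> set ys"
    and least: "\<And>zs. walk_betw y zs z \<Longrightarrow> x \<notin> set zs \<Longrightarrow> length ys \<le> length zs"
    using ex_has_least_nat[of "\<lambda>ys. walk_betw y ys z \<and> x \<notin> set ys" xs length] assms by metis
  have "distinct ys"
  proof (rule ccontr)
    assume "\<not> distinct ys"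
    then obtain as c bs cs where ys_eq: "ys = as @ [c] @ bs @ [c] @ cs"
      using not_distinct_decomp by blast
    have "walk_betw y (as @ [c]) c" "walk_betw c (c # cs) z"
      using ys(1) walk_betw_split[of y as c "bs @ c # cs" z]
        walk_betw_split(2)[of y "as @ c # bs" c cs z] by (auto simp: ys_eq)
    from walk_betw_join[OF this] have "length ys \<le> length (as @ [c] @ cs)"
      using ys(2) by (intro least) (auto simp: ys_eq)
    then show False
      by (simp add: ys_eq)
  qed
  \<comment> \<open>Since \<open>y \<noteq> z\<close>, the walk has at least two vertices; together
    with \<open>x\<close> they reach the length 3 that \<open>cycle\<close> demands.\<close>
  moreover obtain y' ys' where ys': "ys = y # y' # ys'"
    using ys(1) \<open>y \<noteq> z\<close> by (cases ys; cases "tl ys") (auto simp: walk_betw_def walk_def)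
  ultimately have "cycle (x # ys)"
    using ys assms edge_commute by (auto simp: cycle_def walk_betw_def)
  then show False
    using acyclic by blast
qed

text \<open>Geodesics from \<open>v\<close> to \<open>y\<close> and to \<open>z\<close> avoid
  \<open>x\<close>, because their inner vertices are nearer to \<open>v\<close> than their ends;
  joined at \<open>v\<close> they link \<open>y\<close> to \<open>z\<close> without meeting
  \<open>x\<close>. The weak inequality for \<open>z\<close> admits a neighbour as far from
  \<open>v\<close> as \<open>x\<close>, the case used in \<open>gdist_edge\<close>.\<close>

lemma closer_neighbour_unique:
  assumes "v \<in> V" "{x, y} \<in> E" "{x, z} \<in> E" "gdist v y < gdist v x" "gdist v z \<le> gdist v x"
  shows "y = z"
proof -
  note V = edgeD[OF assms(2)] edgeD[OF assms(3)]
  obtain ys zs where g: "geodesic v ys y" "geodesic v zs z"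
    using geodesic_exists assms(1) V by metis
  have "x \<notin> set ys" "x \<notin> set zs"
    using geodesic_gdist_less[OF g(1), of x] geodesic_gdist_less[OF g(2), of x] V assms(4,5)
    by auto
  moreover have "walk_betw y (rev ys @ tl zs) z"
    using g by (auto simp: geodesic_def intro: walk_betw_join walk_betw_rev)
  ultimately show ?thesis
    using assms(2,3) neighbours_eqI[of x y z "rev ys @ tl zs"] by (cases zs; auto)
qed

text \<open>Trees are bipartite: if \<open>x\<close> and \<open>y\<close> were equally far from
  \<open>v\<close>, the neighbour of \<open>x\<close> closer to \<open>v\<close> would have to be
  \<open>y\<close>.\<close>

lemma gdist_edge:
  assumes "v \<in> V" "{x, y} \<in> E"
  shows "gdist v y = gdist v x + 1 \<or> gdist v x = gdist v y + 1"
proof -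
  note V = edgeD[OF assms(2)]
  have "gdist v x \<noteq> gdist v y"
  proof
    assume eq: "gdist v x = gdist v y"
    have "v \<noteq> x"
    proof
      assume "v = x"
      then have "gdist v y = 0"
        using eq V(1) by simp
      then show False
        using gdist_eq_0D[OF assms(1) V(2)] V(3) \<open>v = x\<close> by simp
    qed
    then obtain x' where x': "{x, x'} \<in> E" "gdist v x = gdist v x' + 1"
      using closer_neighbour_exists[OF assms(1) V(1)] by blast
    have "x' = y"
    proof (rule closer_neighbour_unique[OF assms(1) x'(1) assms(2)])
      show "gdist v x' < gdist v x" "gdist v y \<le> gdist v x"
        using x'(2) eq by linarith+
    qed
    then show False
      using x'(2) eq by simp
  qed
  then show ?thesis
    using gdist_edge_le[of v x y] gdist_edge_le[of v y x] assms by (auto simp: insert_commute)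
qed

lemma gball_SucD:
  assumes "x \<in> V" "y \<in> gball x (Suc r)" "y \<notin> gball x r"
  obtains z where "z \<in> gball x r" "{y, z} \<in> E"
proof -
  have y: "y \<in> V" "gdist x y = Suc r"
    using assms by (auto simp: gball_def)
  then have "x \<noteq> y"
    using assms(1) by auto
  then obtain z where "{y, z} \<in> E" "gdist x y = gdist x z + 1"
    using closer_neighbour_exists assms(1) y(1) by metis
  then show thesis
    using that[of z] edgeD[of y z] y by (simp add: gball_def)
qed

end

section \<open>Levels and predecessors\<close>

context rooted_tree
begin

lemma ray_edge: "{ray i, ray (Suc i)} \<in> E"
proof -
  obtain xs where xs: "geodesic (ray i) xs (ray (Suc i))"
    using geodesic_exists ray_in by metis
  moreover have "length xs = 2"
    using xs ray_geodesic[of i "Suc i"] by (simp add: geodesic_def)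
  then obtain a b where "xs = [a, b]"
    by (auto simp: length_Suc_conv eval_nat_numeral)
  ultimately show ?thesis
    by (auto simp: geodesic_def walk_betw_def)
qed

text \<open>The level is the Busemann function of the ray: moving along the ray, the distance to \<open>x\<close>
  has no interior local maximum, so it increases forever after the projection of \<open>x\<close>.\<close>

lemma level_eq_eventually:
  assumes x: "x \<in> V"
  shows "\<exists>N0. \<forall>N\<ge>N0. level x = int N - int (gdist (ray N) x)"
proof -
  have "is_arg_min (gdist x) (\<lambda>v. v \<in> range ray) (proj x)"
    unfolding proj_def by (rule is_arg_min_arg_min_nat[of _ "ray 0"]) auto
  then obtain i where i: "proj x = ray i" and min: "\<And>j. gdist x (ray i) \<le> gdist x (ray j)"
    by (auto simp: is_arg_min_linorder)
  have step: "gdist x (ray (i + Suc k)) = gdist x (ray (i + k)) + 1" for k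
  proof (induction k)
    case 0
    then show ?case
      using gdist_edge[OF x ray_edge, of i] min[of "Suc i"] by auto
  next
    case (Suc k)
    let ?y = "ray (i + Suc k)"
    \<comment> \<open>The vertices before and after \<open>?y\<close> on the ray are distinct; if
      both were closer to \<open>x\<close> than \<open>?y\<close>, they would coincide.\<close>
    have "gdist (ray (i + k)) (ray (i + Suc (Suc k))) = 2"
      by (subst ray_geodesic) auto
    then have ne: "ray (i + k) \<noteq> ray (i + Suc (Suc k))"
      using ray_in by (metis gdist_self zero_neq_numeral)
    have e: "{?y, ray (i + k)} \<in> E" "{?y, ray (i + Suc (Suc k))} \<in> E"
      using ray_edge[of "i + k"] ray_edge[of "i + Suc k"] by (auto simp: insert_commute)
    show ?case
      using gdist_edge[OF x e(2)] closer_neighbour_unique[OF x e] ne Suc.IH by auto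
  qed
  have "gdist x (ray (i + k)) = gdist x (ray i) + k" for k
    by (induction k) (use step in auto)
  then have "level x = int (i + k) - int (gdist (ray (i + k)) x)" for k
    using ray_geodesic[of 0 i] gdist_commute[OF x ray_in] by (simp add: level_def i)
  then show ?thesis
    by (metis le_Suc_ex)
qed

text \<open>Both levels are expressed by distances to \<open>ray N\<close> once \<open>N\<close> is
  large, so \<open>gdist_edge\<close> at a common \<open>N\<close> decides.\<close>

lemma level_edge:
  assumes "{x, y} \<in> E"
  shows "level y = level x + 1 \<or> level x = level y + 1"
proof -
  obtain N1 N2 where N: "\<forall>N\<ge>N1. level x = int N - int (gdist (ray N) x)"
    "\<forall>N\<ge>N2. level y = int N - int (gdist (ray N) y)"
    using level_eq_eventually edgeD[OF assms] by metis
  then show ?thesis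
    using gdist_edge[OF ray_in assms, of "max N1 N2"] N(1)[rule_format, of "max N1 N2"]
      N(2)[rule_format, of "max N1 N2"] by auto
qed

lemma upper_neighbour_exists:
  assumes "x \<in> V"
  obtains y where "{x, y} \<in> E" "level y = level x + 1"
proof -
  obtain N1 where N1: "\<forall>N\<ge>N1. level x = int N - int (gdist (ray N) x)"
    using level_eq_eventually assms by metis
  \<comment> \<open>Besides passing the threshold, \<open>N\<close> exceeds \<open>level x\<close>,
    so \<open>ray N\<close> is not \<open>x\<close>: distance 0 would force
    \<open>level x = N\<close>.\<close>
  define N where "N = max N1 (nat (level x + 1))"
  have "level x = int N - int (gdist (ray N) x)" "level x < int N"
    using N1 unfolding N_def by auto
  then have "ray N \<noteq> x"
    using assms by auto
  then obtain y where y: "{x, y} \<in> E" "gdist (ray N) x = gdist (ray N) y + 1"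
    using closer_neighbour_exists ray_in assms by metis
  obtain N2 where N2: "\<forall>N\<ge>N2. level y = int N - int (gdist (ray N) y)"
    using level_eq_eventually edgeD[OF y(1)] by metis
  \<comment> \<open>The threshold \<open>N2\<close> depends on \<open>y\<close>, which was chosen
    after \<open>N\<close>. Going on from \<open>ray N\<close> to \<open>ray M\<close> costs only
    \<open>M - N\<close>, so the gain made at \<open>N\<close> survives at \<open>M\<close>.\<close>
  define M where "M = max N N2"
  have "gdist (ray M) y \<le> gdist (ray M) (ray N) + gdist (ray N) y"
    using gdist_triangle ray_in edgeD[OF y(1)] by metis
  also have "gdist (ray M) (ray N) = M - N"
    using gdist_commute ray_in ray_geodesic[of N M] by (simp add: M_def)
  finally have "int (gdist (ray M) y) \<le> int M - int N + int (gdist (ray N) y)"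
    by (simp add: M_def)
  moreover have "level y = int M - int (gdist (ray M) y)"
    using N2 by (simp add: M_def)
  ultimately have "level y \<ge> level x + 1"
    using y(2) \<open>level x = int N - int (gdist (ray N) x)\<close> by linarith
  then show thesis
    using that y(1) level_edge[OF y(1)] by auto
qed

text \<open>Seen from a distant \<open>ray N\<close>, both \<open>y\<close> and \<open>z\<close> are
  closer than \<open>x\<close>, and only one neighbour of \<open>x\<close> can be.\<close>

lemma upper_neighbour_unique:
  assumes "{x, y} \<in> E" "level y = level x + 1" "{x, z} \<in> E" "level z = level x + 1"
  shows "y = z"
proof -
  obtain N1 where N1: "\<forall>N\<ge>N1. level x = int N - int (gdist (ray N) x)"
    using level_eq_eventually[OF edgeD(1)[OF assms(1)]] by blast
  obtain N2 where N2: "\<forall>N\<ge>N2. level y = int N - int (gdist (ray N) y)"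
    using level_eq_eventually[OF edgeD(2)[OF assms(1)]] by blast
  obtain N3 where N3: "\<forall>N\<ge>N3. level z = int N - int (gdist (ray N) z)"
    using level_eq_eventually[OF edgeD(2)[OF assms(3)]] by blast
  define N where "N = max N1 (max N2 N3)"
  have "level x = int N - int (gdist (ray N) x)" "level y = int N - int (gdist (ray N) y)"
    "level z = int N - int (gdist (ray N) z)"
    using N1 N2 N3 by (simp_all add: N_def)
  with assms show ?thesis
    by (intro closer_neighbour_unique[of "ray N" x y z]) (auto simp: ray_in)
qed

lemma pred_eqI: "{x, y} \<in> E \<Longrightarrow> level y = level x + 1 \<Longrightarrow> pred x = y"
  unfolding pred_def using upper_neighbour_unique by blast

lemma pred:
  assumes "x \<in> V"
  shows "{x, pred x} \<in> E" "level (pred x) = level x + 1" "pred x \<in> V"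
proof -
  obtain y where y: "{x, y} \<in> E" "level y = level x + 1"
    using upper_neighbour_exists[OF assms] .
  then show "{x, pred x} \<in> E" "level (pred x) = level x + 1" "pred x \<in> V"
    using pred_eqI[OF y] edgeD[OF y(1)] by simp_all
qed

lemma sons_iff: "y \<in> sons x \<longleftrightarrow> y \<in> V \<and> pred y = x"
  using pred[of y] pred_eqI[of y x] edgeD[of x y]
  by (auto simp: sons_def insert_commute)

lemma edge_cases:
  assumes "{x, y} \<in> E"
  shows "y = pred x \<or> x = pred y"
  using level_edge[OF assms] pred_eqI[of x y] pred_eqI[of y x] assms
  by (auto simp: insert_commute)

section \<open>Ascending walks and segments between ancestors\<close>

lemma funpow_pred_in: "x \<in> V \<Longrightarrow> (pred ^^ k) x \<in> V"
  by (induction k) (auto simp: pred)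

lemma level_funpow_pred: "x \<in> V \<Longrightarrow> level ((pred ^^ k) x) = level x + int k"
  by (induction k) (auto simp: pred funpow_pred_in)

lemma level_walk_le:
  "walk_betw x xs y \<Longrightarrow> level y \<le> level x + int (length xs - 1)"
proof (induction xs arbitrary: x rule: induct_list012)
  case (3 a b zs)
  have w: "walk_betw b (b # zs) y" and e: "{x, b} \<in> E"
    using 3(3) by (auto simp: walk_betw_def)
  show ?case
    using 3(2)[OF w] level_edge[OF e] by auto
qed (auto simp: walk_betw_def walk_def)

text \<open>An edge raises the level by at most one, so a walk attaining the bound of
  \<open>level_walk_le\<close> ascends at every edge, and the only ascending edge leads to the
  predecessor.\<close>

lemma steepest_walk:
  assumes "walk_betw x xs y" "level y = level x + int (length xs - 1)"
  shows "set xs = (\<lambda>k. (pred ^^ k) x) ` {..<length xs}"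
  using assms
proof (induction xs arbitrary: x rule: induct_list012)
  case (3 a b zs)
  have w: "walk_betw b (b # zs) y" and e: "{x, b} \<in> E" and a [simp]: "a = x"
    using 3(3) by (auto simp: walk_betw_def)
  have "level b = level x + 1" "level y = level b + int (length zs)"
    using level_walk_le[OF w] level_edge[OF e] 3(4) by auto
  then have "set (b # zs) = (\<lambda>k. (pred ^^ k) b) ` {..<length (b # zs)}" and "b = pred x"
    using 3(2)[OF w] pred_eqI[OF e] by auto
  then have "set (b # zs) = (\<lambda>k. (pred ^^ Suc k) x) ` {..<length (b # zs)}"
    by (simp add: funpow_swap1)
  moreover have "{..<length (a # b # zs)} = insert 0 (Suc ` {..<length (b # zs)})"
    by (simp add: lessThan_Suc_eq_insert_0)
  ultimately show ?case
    by (simp add: image_image del: lessThan_Suc)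
qed (auto simp: walk_betw_def walk_def)

lemma walk_pred:
  assumes "x \<in> V"
  shows "\<exists>xs. walk_betw x xs ((pred ^^ k) x) \<and> length xs = k + 1"
  using assms
proof (induction k arbitrary: x)
  case 0
  then show ?case
    by (intro exI[of _ "[x]"]) simp
next
  case (Suc k)
  then obtain xs where "walk_betw (pred x) xs ((pred ^^ k) (pred x))" "length xs = k + 1"
    using pred(3) by blast
  then show ?case
    using walk_betw_Cons[OF pred(1)[OF Suc.prems]]
    by (intro exI[of _ "x # xs"]) (simp add: funpow_swap1)
qed

text \<open>The ascending walk bounds the distance from above, the level gain of \<open>k\<close>
  from below.\<close>

lemma gdist_funpow_pred:
  assumes "x \<in> V"
  shows "gdist x ((pred ^^ k) x) = k"
proof (rule antisym)
  show "gdist x ((pred ^^ k) x) \<le> k"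
    using walk_pred[OF assms, of k] gdist_le by fastforce
  obtain xs where "geodesic x xs ((pred ^^ k) x)"
    using geodesic_exists assms funpow_pred_in by metis
  then show "k \<le> gdist x ((pred ^^ k) x)"
    using level_walk_le[of x xs "(pred ^^ k) x"] level_funpow_pred[OF assms, of k]
    by (simp add: geodesic_def)
qed

text \<open>The length of every geodesic to the \<open>k\<close>-th ancestor equals its level gain,
  so \<open>steepest_walk\<close> determines its vertices.\<close>

lemma segment_funpow_pred:
  assumes "x \<in> V"
  shows "segment x ((pred ^^ k) x) = (\<lambda>j. (pred ^^ j) x) ` {..k}"
proof -
  have "set xs = (\<lambda>j. (pred ^^ j) x) ` {..k}" if "geodesic x xs ((pred ^^ k) x)" for xs
    using that steepest_walk[of x xs "(pred ^^ k) x"]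
    by (simp add: geodesic_def gdist_funpow_pred level_funpow_pred assms lessThan_Suc_atMost)
  moreover obtain xs where "geodesic x xs ((pred ^^ k) x)"
    using geodesic_exists assms funpow_pred_in by metis
  ultimately show ?thesis
    unfolding segment_def by blast
qed

text \<open>Counting indices instead of vertices makes the recursion in \<open>r\<close> immediate;
  \<open>Suc k\<close> lets the count start at the first predecessor rather than at
  \<open>x\<close>.\<close>

definition branching_ancestors :: "'a \<Rightarrow> nat \<Rightarrow> nat" where
  "branching_ancestors x r = card {k \<in> {..<r}. q ((pred ^^ Suc k) x) \<ge> 2}"

lemma branching_ancestors_0 [simp]: "branching_ancestors x 0 = 0"
  by (simp add: branching_ancestors_def)

lemma branching_ancestors_Suc [simp]:
  "branching_ancestors x (Suc r) =
    (if q (pred ((pred ^^ r) x)) \<ge> 2 then Suc (branching_ancestors x r) else branching_ancestors x r)"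
proof -
  have "{k \<in> {..<Suc r}. q ((pred ^^ Suc k) x) \<ge> 2} =
      (if q (pred ((pred ^^ r) x)) \<ge> 2 then insert r else id)
        {k \<in> {..<r}. q ((pred ^^ Suc k) x) \<ge> 2}"
    by (auto simp: less_Suc_eq)
  then show ?thesis
    by (simp add: branching_ancestors_def)
qed

text \<open>Distinct ancestors have distinct levels, so indices and vertices are counted alike. For
  \<open>r = 0\<close> the segment would run backwards from the predecessor to
  \<open>x\<close>.\<close>

lemma branch_count_segment:
  assumes "x \<in> V" "r > 0"
  shows "branch_count (segment ((pred ^^ 1) x) ((pred ^^ r) x)) = branching_ancestors x r"
proof -
  define f where "f k = (pred ^^ Suc k) x" for k
  have "(pred ^^ (r - 1)) (pred x) = (pred ^^ r) x"
    using assms(2) by (cases r) (auto simp: funpow_swap1)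
  then have "segment ((pred ^^ 1) x) ((pred ^^ r) x) = f ` {..r - 1}"
    using segment_funpow_pred[of "pred x" "r - 1"] pred(3)[OF assms(1)]
    by (simp add: funpow_swap1 f_def)
  moreover have "{..r - 1} = {..<r}"
    using assms(2) by auto
  ultimately have S: "{y \<in> segment ((pred ^^ 1) x) ((pred ^^ r) x). q y \<ge> 2} =
      f ` {k \<in> {..<r}. q (f k) \<ge> 2}"
    by auto
  have inj: "inj f"
  proof
    fix i j assume "f i = f j"
    then have "level (f i) = level (f j)"
      by simp
    then show "i = j"
      unfolding f_def level_funpow_pred[OF assms(1)] by simp
  qed
  have C: "card (f ` {k \<in> {..<r}. q (f k) \<ge> 2}) = card {k \<in> {..<r}. q (f k) \<ge> 2}"
    by (rule card_image[OF inj_on_subset[OF inj subset_UNIV]])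
  show ?thesis
    unfolding branch_count_def S C by (simp only: branching_ancestors_def f_def)
qed

section \<open>Generations of descendants and balls\<close>

definition descendants :: "nat \<Rightarrow> 'a \<Rightarrow> 'a set" where
  "descendants k x = {y \<in> V. (pred ^^ k) y = x}"

lemma descendants_0: "x \<in> V \<Longrightarrow> descendants 0 x = {x}"
  by (auto simp: descendants_def)

text \<open>Generation \<open>Suc k\<close> is sorted by the \<open>k\<close>-th ancestor of its
  members, a son of \<open>x\<close>.\<close>

lemma descendants_Suc: "descendants (Suc k) x = (\<Union>z\<in>sons x. descendants k z)"
  by (auto simp: descendants_def sons_iff funpow_pred_in)

text \<open>Enlarging the radius by one moves the apex up to the next ancestor and allows one
  further step down; each may add a generation, hence \<open>2 * r\<close>.\<close>

lemma gball_subset_descendants: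
  assumes "x \<in> V"
  shows "gball x r \<subseteq> (\<Union>k\<le>2 * r. descendants k ((pred ^^ r) x))"
proof (induction r)
  case 0
  have "gball x 0 \<subseteq> {x}"
    using gdist_eq_0D[OF assms] by (auto simp: gball_def)
  then show ?case
    using assms by (simp add: descendants_0)
next
  case (Suc r)
  show ?case
  proof
    fix y assume y: "y \<in> gball x (Suc r)"
    then have yV: "y \<in> V"
      by (simp add: gball_def)
    have "\<exists>k\<le>2 * Suc r. (pred ^^ k) y = (pred ^^ Suc r) x"
    proof (cases "y \<in> gball x r")
      case True
      then obtain k where "k \<le> 2 * r" "(pred ^^ k) y = (pred ^^ r) x"
        using Suc.IH by (auto simp: descendants_def)
      then show ?thesis
        by (intro exI[of _ "Suc k"]) auto
    next
      case False
      then obtain z where z: "z \<in> gball x r" "{y, z} \<in> E"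
        using gball_SucD assms y by metis
      then obtain k where k: "k \<le> 2 * r" "(pred ^^ k) z = (pred ^^ r) x"
        using Suc.IH by (auto simp: descendants_def)
      \<comment> \<open>A step down from \<open>z\<close> adds a second generation to the one from
        the rise of the apex. A step up from the old apex (\<open>k = 0\<close>) reaches the new
        one; any other step up offsets the rise, so \<open>k\<close> is kept.\<close>
      consider "z = pred y" | "y = pred z" "k = 0" | k' where "y = pred z" "k = Suc k'"
        using edge_cases[OF z(2)] by (cases k) auto
      then show ?thesis
      proof cases
        case 1
        then show ?thesis
          using k by (intro exI[of _ "Suc (Suc k)"]) (simp add: funpow_swap1)
      next
        case 2
        then show ?thesis
          using k by (intro exI[of _ 0]) simp
      next
        case 3
        then show ?thesis
          using k by (intro exI[of _ k]) (simp add: funpow_swap1)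
      qed
    qed
    then show "y \<in> (\<Union>k\<le>2 * Suc r. descendants k ((pred ^^ Suc r) x))"
      using yV by (auto simp: descendants_def simp del: funpow.simps)
  qed
qed

end

section \<open>Flow measures\<close>

lemma mass_finite:
  assumes "finite A" "\<And>x. x \<in> A \<Longrightarrow> m x \<ge> 0"
  shows "mass m A = ennreal (sum m A)"
  using assms by (simp add: mass_def sum_ennreal)

lemma mass_mono: "A \<subseteq> B \<Longrightarrow> mass m A \<le> mass m B"
  unfolding mass_def
  by (rule infsum_mono_neutral) (auto intro: nonneg_summable_on_complete)

lemma mass_insert_le: "mass m (insert x A) \<le> ennreal (m x) + mass m A"
proof (cases "x \<in> A")
  case False
  then have "mass m ({x} \<union> A) = mass m {x} + mass m A"
    unfolding mass_def by (intro infsum_Un_disjoint) (auto intro: nonneg_summable_on_complete)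
  then show ?thesis
    by (simp add: mass_def)
qed (simp add: insert_absorb)

locale doubling_flow = rooted_tree +
  fixes m :: "'a \<Rightarrow> real"
  assumes flow: "flow_measure m"
    and doubling: "locally_doubling m"
begin

section \<open>Doubling constant and finiteness of degrees\<close>

lemma pos: "x \<in> V \<Longrightarrow> m x > 0"
  using flow by (simp add: flow_measure_def)

lemma mass_sons: "x \<in> V \<Longrightarrow> mass m (sons x) = ennreal (m x)"
  using flow by (simp add: flow_measure_def)

text \<open>Restricted to finite sets of sons because \<open>sons x\<close> is not yet known to be
  finite; \<open>finite_sons\<close> rests on this bound.\<close>

lemma sum_sons_le:
  assumes "x \<in> V" "finite A" "A \<subseteq> sons x"
  shows "sum m A \<le> m x"
proof -
  have nn: "m y \<ge> 0" if "y \<in> A" for y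
    using that assms(3) pos[of y] by (auto simp: sons_iff)
  have "ennreal (sum m A) \<le> ennreal (m x)"
    using mass_mono[OF assms(3), of m] mass_sons[OF assms(1)] mass_finite[of A m] assms(2) nn by simp
  then show ?thesis
    using pos[OF assms(1)] by (simp add: ennreal_le_iff)
qed

lemma le_pred: "x \<in> V \<Longrightarrow> m x \<le> m (pred x)"
  using sum_sons_le[of "pred x" "{x}"] pred(3) by (simp add: sons_iff)

lemma sons_nonempty: "x \<in> V \<Longrightarrow> sons x \<noteq> {}"
  using mass_sons[of x] pos[of x] by (auto simp: mass_def)

text \<open>Doubling is not available for balls of radius \<open>0\<close>, so the balls are centred at a son \<open>y\<close> of \<open>x\<close>:
  the ball of radius \<open>2\<close> reaches \<open>pred x\<close>, the one of radius \<open>1\<close> has mass at most \<open>3 * m x\<close>.\<close>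

lemma pred_le_mult: "\<exists>D>1. \<forall>x\<in>V. m (pred x) \<le> D * m x"
proof -
  obtain C where C: "C > 1" "\<And>x. x \<in> V \<Longrightarrow> mass m (gball x 2) \<le> ennreal C * mass m (gball x 1)"
    using doubling unfolding locally_doubling_def by (metis mult_1_right zero_less_one)
  have "m (pred x) \<le> 3 * C * m x" if x: "x \<in> V" for x
  proof -
    obtain y where "y \<in> sons x"
      using sons_nonempty[OF x] by blast
    then have y: "y \<in> V" "pred y = x"
      by (simp_all add: sons_iff)
    \<comment> \<open>The neighbours of \<open>y\<close> are its predecessor \<open>x\<close> and
      its sons, and the sons together weigh \<open>m y\<close>.\<close>
    have "z \<in> insert y (insert x (sons y))" if z: "z \<in> gball y 1" for z
    proof (cases "z \<in> gball y 0")
      case True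
      then show ?thesis
        using gdist_eq_0D y by (auto simp: gball_def)
    next
      case False
      obtain u where u: "u \<in> gball y 0" "{z, u} \<in> E"
        using gball_SucD[OF y(1) _ False] z by auto
      then have "u = y"
        using gdist_eq_0D y by (auto simp: gball_def)
      then show ?thesis
        using edge_cases[OF u(2)] edgeD[OF u(2)] y by (auto simp: sons_iff)
    qed
    then have "mass m (gball y 1) \<le> mass m (insert y (insert x (sons y)))"
      by (intro mass_mono) blast
    also have "\<dots> \<le> ennreal (m y) + (ennreal (m x) + mass m (sons y))"
      by (meson add_left_mono mass_insert_le order_trans)
    also have "\<dots> = ennreal (m y + (m x + m y))"
      using mass_sons[OF y(1)] pos[OF y(1)] pos[OF x]
      by (simp add: less_imp_le flip: ennreal_plus)
    also have "\<dots> \<le> ennreal (3 * m x)"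
      using le_pred[OF y(1)] y(2) by (intro ennreal_leI) simp
    finally have ball: "mass m (gball y 1) \<le> ennreal (3 * m x)" .
    have "pred x \<in> gball y 2"
      using gdist_funpow_pred[OF y(1), of 2] pred(3)[OF x] y(2)
      by (simp add: gball_def eval_nat_numeral)
    then have "ennreal (m (pred x)) \<le> mass m (gball y 2)"
      using mass_mono[of "{pred x}" "gball y 2" m] by (simp add: mass_def)
    also have "\<dots> \<le> ennreal C * ennreal (3 * m x)"
      by (rule order_trans[OF C(2)[OF y(1)] mult_left_mono[OF ball]]) simp
    also have "\<dots> = ennreal (3 * C * m x)"
      using C(1) pos[OF x] by (subst ennreal_mult[symmetric]) (simp_all add: mult_ac)
    finally show ?thesis
      using C(1) pos[OF x] by (simp add: ennreal_le_iff)
  qed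
  then show ?thesis
    using C(1) by (intro exI[of _ "3 * C"]) auto
qed

definition "D = (SOME D. D > 1 \<and> (\<forall>x\<in>V. m (pred x) \<le> D * m x))"

lemma D_gt_1: "D > 1" and pred_le: "x \<in> V \<Longrightarrow> m (pred x) \<le> D * m x"
  using someI_ex[OF pred_le_mult] unfolding D_def by blast+

lemma son_ge: "y \<in> sons x \<Longrightarrow> m x / D \<le> m y"
  using pred_le[of y] D_gt_1 by (auto simp: sons_iff field_simps)

text \<open>Each son carries at least \<open>m x / D\<close>, so more than \<open>D\<close> sons
  would outweigh \<open>x\<close>.\<close>

lemma finite_sons:
  assumes "x \<in> V"
  shows "finite (sons x)"
proof (rule ccontr)
  assume "infinite (sons x)"
  then obtain A where A: "A \<subseteq> sons x" "finite A" "card A = nat \<lceil>D\<rceil> + 1"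
    using infinite_arbitrarily_large by blast
  have "D < real (card A)"
    using A(3) D_gt_1 by linarith
  then have "m x < real (card A) * (m x / D)"
    using D_gt_1 pos[OF assms] by (simp add: field_simps)
  also have "\<dots> \<le> sum m A"
    using A(1) son_ge by (intro sum_bounded_below) blast
  finally show False
    using sum_sons_le[OF assms A(2,1)] by simp
qed

lemma sum_sons: "x \<in> V \<Longrightarrow> sum m (sons x) = m x"
proof -
  assume x: "x \<in> V"
  have nn: "m y \<ge> 0" if "y \<in> sons x" for y
    using that pos[of y] by (simp add: sons_iff)
  then have "ennreal (sum m (sons x)) = ennreal (m x)"
    using mass_finite[OF finite_sons[OF x], of m] mass_sons[OF x] by simp
  then show ?thesis
    using nn pos[OF x] by (simp add: sum_nonneg)
qed

section \<open>Growth of the measure along predecessors\<close>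

lemma q_eq_card: "x \<in> V \<Longrightarrow> q x = enat (card (sons x))"
  by (simp add: q_def finite_sons)

lemma pred_eq:
  assumes "x \<in> V" "\<not> q (pred x) \<ge> 2"
  shows "m (pred x) = m x"
proof -
  have p: "pred x \<in> V" "x \<in> sons (pred x)"
    using assms(1) pred(3)[OF assms(1)] by (simp_all add: sons_iff)
  then have "card (sons (pred x)) \<le> 1"
    using assms(2) q_eq_card[OF p(1)] by (simp add: numeral_eq_enat)
  then have "sons (pred x) = {x}"
    using p(2) card_le_Suc0_iff_eq[OF finite_sons[OF p(1)]] by auto
  then show ?thesis
    using sum_sons[OF p(1)] by simp
qed

text \<open>A second son \<open>z\<close> carries at least the fraction \<open>1 / D\<close> of the
  mass of \<open>pred x\<close>, hence at least \<open>m x / D\<close>, on top of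
  \<open>m x\<close>.\<close>

lemma pred_ge:
  assumes "x \<in> V" "q (pred x) \<ge> 2"
  shows "m (pred x) \<ge> (1 + 1 / D) * m x"
proof -
  have p: "pred x \<in> V" "x \<in> sons (pred x)"
    using assms(1) pred(3)[OF assms(1)] by (simp_all add: sons_iff)
  then have "card (sons (pred x)) \<ge> 2"
    using assms(2) q_eq_card[OF p(1)] by (simp add: numeral_eq_enat)
  then have "\<not> sons (pred x) \<subseteq> {x}"
    using card_mono[of "{x}" "sons (pred x)"] by fastforce
  then obtain z where z: "z \<in> sons (pred x)" "z \<noteq> x"
    by blast
  have "m x + m z \<le> m (pred x)"
    using sum_sons_le[OF p(1), of "{x, z}"] z p(2) by simp
  moreover have "m x / D \<le> m (pred x) / D"
    using le_pred[OF assms(1)] D_gt_1 by (simp add: divide_right_mono)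
  ultimately show ?thesis
    using son_ge[OF z(1)] by (simp add: algebra_simps)
qed

text \<open>By \<open>pred_eq\<close> only steps to branching predecessors contribute a factor, at
  most \<open>D\<close> each.\<close>

lemma funpow_pred_le:
  assumes "x \<in> V"
  shows "m ((pred ^^ r) x) \<le> D ^ branching_ancestors x r * m x"
proof (induction r)
  case (Suc r)
  let ?y = "(pred ^^ r) x"
  have y: "?y \<in> V"
    using funpow_pred_in[OF assms] .
  show ?case
  proof (cases "q (pred ?y) \<ge> 2")
    case True
    have "m (pred ?y) \<le> D * (D ^ branching_ancestors x r * m x)"
      using pred_le[OF y] mult_left_mono[OF Suc.IH, of D] D_gt_1 by linarith
    then show ?thesis
      using True by (simp add: mult.assoc)
  next
    case False
    then show ?thesis
      using Suc.IH pred_eq[OF y] by simp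
  qed
qed simp

lemma funpow_pred_ge:
  assumes "x \<in> V"
  shows "m ((pred ^^ r) x) \<ge> (1 + 1 / D) ^ branching_ancestors x r * m x"
proof (induction r)
  case (Suc r)
  let ?y = "(pred ^^ r) x"
  have y: "?y \<in> V"
    using funpow_pred_in[OF assms] .
  show ?case
  proof (cases "q (pred ?y) \<ge> 2")
    case True
    have "1 + 1 / D > 0"
      using D_gt_1 by (simp add: add_pos_pos)
    then have "m (pred ?y) \<ge> (1 + 1 / D) * ((1 + 1 / D) ^ branching_ancestors x r * m x)"
      using pred_ge[OF y True] mult_left_mono[OF Suc.IH, of "1 + 1 / D"] by linarith
    then show ?thesis
      using True by (simp add: mult.assoc)
  next
    case False
    then show ?thesis
      using Suc.IH pred_eq[OF y] by simp
  qed
qed simp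

text \<open>The flow equation passes mass undiminished to the sons; descendants of different sons in
  the same generation are disjoint because a \<open>k\<close>-th ancestor is unique.\<close>

lemma descendants:
  assumes "x \<in> V"
  shows "finite (descendants k x) \<and> sum m (descendants k x) = m x"
  using assms
proof (induction k arbitrary: x)
  case (Suc k)
  have IH: "finite (descendants k z)" "sum m (descendants k z) = m z" if "z \<in> sons x" for z
    using Suc.IH[of z] that by (auto simp: sons_iff)
  have "sum m (\<Union>z\<in>sons x. descendants k z) = (\<Sum>z\<in>sons x. sum m (descendants k z))"
    using IH finite_sons[OF Suc.prems]
    by (intro sum.UNION_disjoint) (auto simp: descendants_def)
  then show ?case
    using IH finite_sons[OF Suc.prems] sum_sons[OF Suc.prems] by (simp add: descendants_Suc)
qed (simp add: descendants_0)

section \<open>Mass of balls against mass of ancestors\<close>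

lemma mass_gball_ge:
  assumes "x \<in> V"
  shows "mass m (gball x r) \<ge> ennreal (m ((pred ^^ r) x))"
  using mass_mono[of "{(pred ^^ r) x}" "gball x r" m] assms
  by (simp add: gball_def gdist_funpow_pred funpow_pred_in mass_def)

lemma mass_gball_le:
  assumes "x \<in> V"
  shows "mass m (gball x r) \<le> ennreal ((2 * real r + 1) * m ((pred ^^ r) x))"
proof -
  let ?y = "(pred ^^ r) x" and ?A = "\<Union>k\<le>2 * r. descendants k ((pred ^^ r) x)"
  have y: "?y \<in> V"
    using funpow_pred_in[OF assms] .
  have "sum m ?A = (\<Sum>k\<le>2 * r. sum m (descendants k ?y))"
  proof (intro sum.UNION_disjoint ballI impI)
    \<comment> \<open>A common vertex would have the apex both \<open>i\<close> and \<open>j\<close>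
      levels above it.\<close>
    fix i j :: nat assume "i \<noteq> j"
    then show "descendants i ?y \<inter> descendants j ?y = {}"
      unfolding descendants_def using level_funpow_pred
      by (smt (verit) disjoint_iff mem_Collect_eq of_nat_eq_iff)
  qed (use descendants[OF y] in auto)
  also have "\<dots> = (2 * real r + 1) * m ?y"
    using descendants[OF y] by simp
  finally have "mass m ?A = ennreal ((2 * real r + 1) * m ?y)"
    using mass_finite[of ?A m] descendants[OF y] pos
    by (simp add: descendants_def less_imp_le)
  then show ?thesis
    using mass_mono[OF gball_subset_descendants[OF assms, of r], of m] by simp
qed

section \<open>The two implications\<close>

lemma exp_growth_imp_branching:
  assumes x: "x \<in> V" and "\<beta> > 0" "\<alpha> > 0"
    and growth: "\<And>r. r > r0 \<Longrightarrow> mass m (gball x r) \<ge> ennreal (\<beta> * exp (\<alpha> * real r))"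
  shows "\<exists>r1 \<gamma>. \<gamma> > 0 \<and> (\<forall>r>r1. real (branching_ancestors x r) \<ge> \<gamma> * real r)"
proof -
  \<comment> \<open>Half of the exponential rate absorbs the linear factor and the constants; the
    other half remains for comparison with the power of \<open>D\<close>.\<close>
  have "eventually (\<lambda>r::nat. (2 * real r + 1) * (m x / \<beta>) \<le> exp (\<alpha> / 2 * real r)) at_top"
    using pos[OF x] \<open>\<beta> > 0\<close> \<open>\<alpha> > 0\<close> by real_asymp
  then obtain r1 where r1: "\<And>r::nat. r \<ge> r1 \<Longrightarrow> (2 * real r + 1) * (m x / \<beta>) \<le> exp (\<alpha> / 2 * real r)"
    by (auto simp: eventually_at_top_linorder)
  \<comment> \<open>The constant comes from taking logarithms in
    \<open>?e \<le> D ^ ?n\<close>.\<close>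
  have "real (branching_ancestors x r) \<ge> \<alpha> / (2 * ln D) * real r" if r: "r > max r0 r1" for r
  proof -
    let ?n = "branching_ancestors x r" and ?e = "exp (\<alpha> / 2 * real r)"
    have "ennreal (\<beta> * exp (\<alpha> * real r)) \<le> ennreal ((2 * real r + 1) * m ((pred ^^ r) x))"
      using growth[of r] mass_gball_le[OF x, of r] r by simp
    then have "\<beta> * exp (\<alpha> * real r) \<le> (2 * real r + 1) * m ((pred ^^ r) x)"
      using pos[OF funpow_pred_in[OF x, of r]] by (simp add: ennreal_le_iff)
    also have "\<dots> \<le> (2 * real r + 1) * (D ^ ?n * m x)"
      using funpow_pred_le[OF x] by (intro mult_left_mono) auto
    also have "\<dots> = \<beta> * D ^ ?n * ((2 * real r + 1) * (m x / \<beta>))"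
      using \<open>\<beta> > 0\<close> by simp
    also have "\<dots> \<le> \<beta> * D ^ ?n * ?e"
      using r1[of r] r \<open>\<beta> > 0\<close> D_gt_1 by (intro mult_left_mono) auto
    also have "exp (\<alpha> * real r) = ?e * ?e"
      by (simp flip: exp_add)
    finally have "?e \<le> D ^ ?n"
      using \<open>\<beta> > 0\<close> by simp
    then have "\<alpha> / 2 * real r \<le> ln (D ^ ?n)"
      using D_gt_1 by (subst ln_ge_iff) auto
    also have "\<dots> = real ?n * ln D"
      using D_gt_1 by (simp add: ln_realpow)
    finally show ?thesis
      using D_gt_1 by (simp add: field_simps)
  qed
  then show ?thesis
    using \<open>\<alpha> > 0\<close> D_gt_1 by (intro exI[of _ "max r0 r1"] exI[of _ "\<alpha> / (2 * ln D)"]) auto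
qed

text \<open>Already the single vertex \<open>(pred ^^ r) x\<close> of the ball is heavy enough;
  writing the power of \<open>1 + 1 / D\<close> from \<open>funpow_pred_ge\<close> as an exponential
  yields the rate.\<close>

lemma branching_imp_exp_growth:
  assumes x: "x \<in> V" and "\<alpha> > 0"
    and branching: "real (branching_ancestors x r) \<ge> \<alpha> * real r"
  shows "mass m (gball x r) \<ge> ennreal (m x * exp (\<alpha> * ln (1 + 1 / D) * real r))"
proof -
  let ?K = "1 + 1 / D" and ?n = "branching_ancestors x r"
  have K: "?K > 1"
    using D_gt_1 by simp
  have "exp (\<alpha> * ln ?K * real r) = exp (\<alpha> * real r * ln ?K)"
    by (simp add: algebra_simps)
  also have "\<dots> \<le> exp (real ?n * ln ?K)"
    using branching K by (simp add: mult_right_mono)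
  also have "\<dots> = ?K ^ ?n"
    using K by (simp only: exp_of_nat_mult exp_ln_iff[THEN iffD2])
  finally have "m x * exp (\<alpha> * ln ?K * real r) \<le> m x * ?K ^ ?n"
    using pos[OF x] by simp
  also have "\<dots> \<le> m ((pred ^^ r) x)"
    using funpow_pred_ge[OF x, of r] by (simp add: mult.commute)
  finally show ?thesis
    using mass_gball_ge[OF x, of r] ennreal_leI order_trans by blast
qed

lemma growth_iff:
  "at_least_exp_growth m \<longleftrightarrow>
    (\<forall>x\<in>V. \<exists>(r0::nat) (\<alpha>::real). \<alpha> > 0 \<and>
      (\<forall>r>r0. real (branch_count (segment ((pred ^^ 1) x) ((pred ^^ r) x))) \<ge> \<alpha> * real r))"
    (is "_ \<longleftrightarrow> ?R")
proof
  assume g: "at_least_exp_growth m"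
  show ?R
  proof
    fix x assume x: "x \<in> V"
    obtain r1 \<gamma> where "\<gamma> > 0" "\<forall>r>r1. real (branching_ancestors x r) \<ge> \<gamma> * real r"
      using g x exp_growth_imp_branching[OF x] unfolding at_least_exp_growth_def by metis
    \<comment> \<open>Here \<open>r > r1\<close> makes \<open>r\<close> positive, as
      \<open>branch_count_segment\<close> requires.\<close>
    then show "\<exists>(r0::nat) (\<alpha>::real). \<alpha> > 0 \<and>
        (\<forall>r>r0. real (branch_count (segment ((pred ^^ 1) x) ((pred ^^ r) x))) \<ge> \<alpha> * real r)"
      using branch_count_segment[OF x] by (intro exI[of _ r1] exI[of _ \<gamma>]) auto
  qed
next
  assume R: ?R
  show "at_least_exp_growth m"
    unfolding at_least_exp_growth_def
  proof
    fix x assume x: "x \<in> V"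
    with R obtain r0 :: nat and \<alpha> :: real where \<alpha>: "\<alpha> > 0"
      and "\<forall>r>r0. real (branch_count (segment ((pred ^^ 1) x) ((pred ^^ r) x))) \<ge> \<alpha> * real r"
      by blast
    then have "mass m (gball x r) \<ge> ennreal (m x * exp (\<alpha> * ln (1 + 1 / D) * real r))" if "r > r0" for r
      using that branching_imp_exp_growth[OF x \<alpha>] branch_count_segment[OF x, of r] by auto
    \<comment> \<open>The prefactor is \<open>m x\<close>, and the rate is positive because
      \<open>1 + 1 / D\<close> exceeds 1.\<close>
    then show "\<exists>(r0::nat) (\<beta>::real) (\<alpha>::real). \<beta> > 0 \<and> \<alpha> > 0 \<and>
        (\<forall>r>r0. mass m (gball x r) \<ge> ennreal (\<beta> * exp (\<alpha> * real r)))"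
      using pos[OF x] mult_pos_pos[OF \<alpha> ln_gt_zero[of "1 + 1 / D"]] D_gt_1
      by (intro exI[of _ r0] exI[of _ "m x", OF exI[of _ "\<alpha> * ln (1 + 1 / D)"]]) auto
  qed
qed

end

theorem proposition2p8:
  fixes V :: "'a set" and E :: "'a set set" and ray :: "nat \<Rightarrow> 'a" and m :: "'a \<Rightarrow> real"
  assumes "rooted_tree V E ray"
    and "rooted_tree.flow_measure V E ray m"
    and "rooted_tree.locally_doubling V E m"
  shows "rooted_tree.at_least_exp_growth V E m \<longleftrightarrow>
    (\<forall>x0\<in>V. \<exists>(r0::nat) (\<alpha>::real). \<alpha> > 0 \<and>
      (\<forall>r>r0. real (rooted_tree.branch_count V E ray
          (simple_graph.segment V E
            ((rooted_tree.pred V E ray ^^ 1) x0) ((rooted_tree.pred V E ray ^^ r) x0)))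
        \<ge> \<alpha> * real r))"
proof -
  interpret doubling_flow V E ray m
    by (intro doubling_flow.intro doubling_flow_axioms.intro assms)
  show ?thesis
    by (rule growth_iff)
qed

end
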